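(* Let $D$ be a digraph obtained from a tournament by deleting the edges of pairwise disjoint stars $S_1,\dots,S_n$ with centers $x_1,\dots,x_n$ respectively. Suppose that in the tournament $D[\{x_1,\dots,x_n\}]$ induced by the centers of the missing stars, every vertex is a king. If every vertex of the dependency digraph $\Delta$ of $D$ has in-degree at least $1$ in $\Delta$ (i.e. $\delta^-_\Delta>0$), then $D$ satisfies the second neighborhood conjecture, that is, there is a vertex $v\in V(D)$ with $d^+_D(v)\le d^{++}_D(v)$.
   Context: All digraphs are finite with nonempty vertex set. An oriented graph is a digraph without loops and without digons (directed cycles of length two); a tournament is an oriented graph in which every two distinct vertices are adjacent. Write $x\rightarrow y$ if $(x,y)$ is an arc. $N^+(v)$ is the set of out-neighbors of $v$ and $N^{++}(v)$ is the set of vertices at distance exactly $2$ from $v$ (reached from $v$ by a directed path of length 2 but not by one of length 0 or 1); $d^+(v)=|N^+(v)|$, $d^{++}(v)=|N^{++}(v)|$. For distinct vertices $x,y$ of $D$, $xy$ is a missing edge if neither $(x,y)$ nor $(y,x)$ is an arc of $D$. A star of center $x$ is a graph whose edge set has the form $\{a_ix : i=1,\dots,k\}$ with $k\ge 1$, the $a_i$ distinct and different from $x$ (when $k=1$, one of the two endpoints is designated as center). Stars are disjoint if no two of them share a vertex. Deleting the edges of the stars from a tournament means removing the arc joining the two endpoints of each star edge; thus the missing edges of $D$ are exactly the edges of $S_1,\dots,S_n$. A vertex $x$ of a tournament $T$ is a king if $\{x\}\cup N_T^+(x)\cup N_T^{++}(x)=V(T)$. Dependency digraph: for missing edges $e$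 and $e'$ of $D$, $e$ loses to $e'$ if the endpoints can be named $e=x_1y_1$, $e'=x_2y_2$ so that $x_1\rightarrow x_2$, $y_2\notin N^+(x_1)\cup N^{++}(x_1)$, $y_1\rightarrow y_2$ and $x_2\notin N^+(y_1)\cup N^{++}(y_1)$. The dependency digraph $\Delta$ of $D$ has the missing edges of $D$ as vertices, and an arc $(e,e')$ whenever $e$ loses to $e'$ (digons in $\Delta$ are allowed). *)

theory Defs
  imports "Graph_Theory.Digraph_Component" "HOL-Library.Disjoint_Sets"
begin

definition oriented_graph :: "('a, 'b) pre_digraph \<Rightarrow> bool" where
  "oriented_graph G \<longleftrightarrow>
     digraph G \<and> verts G \<noteq> {} \<and> (\<forall>u v. \<not> (u \<rightarrow>\<^bsub>G\<^esub> v \<and> v \<rightarrow>\<^bsub>G\<^esub> u))"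

definition tournament :: "('a, 'b) pre_digraph \<Rightarrow> bool" where
  "tournament G \<longleftrightarrow> oriented_graph G \<and>
     (\<forall>u \<in> verts G. \<forall>v \<in> verts G. u \<noteq> v \<longrightarrow> u \<rightarrow>\<^bsub>G\<^esub> v \<or> v \<rightarrow>\<^bsub>G\<^esub> u)"

definition out_nbrs :: "('a, 'b) pre_digraph \<Rightarrow> 'a \<Rightarrow> 'a set" where
  "out_nbrs G v = {w. v \<rightarrow>\<^bsub>G\<^esub> w}"

definition second_out_nbrs :: "('a, 'b) pre_digraph \<Rightarrow> 'a \<Rightarrow> 'a set" where
  "second_out_nbrs G v = {w. w \<noteq> v \<and> \<not> v \<rightarrow>\<^bsub>G\<^esub> w \<and> (\<exists>u. v \<rightarrow>\<^bsub>G\<^esub> u \<and> u \<rightarrow>\<^bsub>G\<^esub> w)}"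

definition king :: "('a, 'b) pre_digraph \<Rightarrow> 'a \<Rightarrow> bool" where
  "king G v \<longleftrightarrow> v \<in> verts G \<and> {v} \<union> out_nbrs G v \<union> second_out_nbrs G v = verts G"

text \<open>Undirected edges are represented by their two-element sets of endpoints.\<close>

definition underlying_edges :: "('a, 'b) pre_digraph \<Rightarrow> 'a set set" where
  "underlying_edges G = (\<lambda>e. {tail G e, head G e}) ` arcs G"

definition delete_edges :: "('a, 'b) pre_digraph \<Rightarrow> 'a set set \<Rightarrow> ('a, 'b) pre_digraph" where
  "delete_edges G E = G\<lparr>arcs := {e \<in> arcs G. {tail G e, head G e} \<notin> E}\<rparr>"

text \<open>
  A star is given by its edge set; since it has at least one edge, its vertex set is the
  union of its edges. For a single edge, either endpoint may serve as the center.
\<close>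

definition star_with_center :: "'a \<Rightarrow> 'a set set \<Rightarrow> bool" where
  "star_with_center x E \<longleftrightarrow>
     (\<exists>A. finite A \<and> A \<noteq> {} \<and> x \<notin> A \<and> E = (\<lambda>a. {a, x}) ` A)"

definition missing_edges :: "('a, 'b) pre_digraph \<Rightarrow> 'a set set" where
  "missing_edges G = {{x, y} | x y. x \<in> verts G \<and> y \<in> verts G \<and> x \<noteq> y \<and>
     \<not> x \<rightarrow>\<^bsub>G\<^esub> y \<and> \<not> y \<rightarrow>\<^bsub>G\<^esub> x}"

definition loses_to :: "('a, 'b) pre_digraph \<Rightarrow> 'a set \<Rightarrow> 'a set \<Rightarrow> bool" where
  "loses_to G e e' \<longleftrightarrow> (\<exists>x1 y1 x2 y2. e = {x1, y1} \<and> e' = {x2, y2} \<and>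
     x1 \<rightarrow>\<^bsub>G\<^esub> x2 \<and> y2 \<notin> out_nbrs G x1 \<union> second_out_nbrs G x1 \<and>
     y1 \<rightarrow>\<^bsub>G\<^esub> y2 \<and> x2 \<notin> out_nbrs G y1 \<union> second_out_nbrs G y1)"

definition dependency_digraph ::
  "('a, 'b) pre_digraph \<Rightarrow> ('a set, 'a set \<times> 'a set) pre_digraph" where
  "dependency_digraph G = with_proj
     \<lparr>pverts = missing_edges G,
      parcs = {(e, e'). e \<in> missing_edges G \<and> e' \<in> missing_edges G \<and> loses_to G e e'}\<rparr>"

end

theory Submission
  imports Defs
begin

text \<open>
  Orient every missing edge from the leaf to the center and take a median order of the resulting
  tournament, with last vertex \<open>f\<close>. Since all centers are kings, an edge \<open>{c\<^sub>1, a\<^sub>1}\<close> losing to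
  \<open>{c\<^sub>2, a\<^sub>2}\<close> forces the 4-cycle \<open>c\<^sub>1 \<rightarrow> c\<^sub>2 \<rightarrow> a\<^sub>1 \<rightarrow> a\<^sub>2 \<rightarrow> c\<^sub>1\<close>, and so a path \<open>f \<rightarrow> a\<^sub>2 \<rightarrow> c\<^sub>2\<close>
  through an added arc can be replaced by \<open>f \<rightarrow> c\<^sub>1 \<rightarrow> c\<^sub>2\<close> unless \<open>f\<close> is a leaf of \<open>c\<^sub>1\<close>. In that
  case at most one such \<open>c\<^sub>2\<close> is lost, and the loss is made up for by \<open>c\<^sub>1\<close>: it is a second
  out-neighbor of \<open>f\<close>, and either it is not counted by the median order argument or the backward
  arc from \<open>f\<close> to \<open>c\<^sub>1\<close> makes the median inequality strict.
\<close>

section \<open>Median orders\<close>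

definition forward_arcs :: "'a set \<Rightarrow> ('a \<Rightarrow> 'a \<Rightarrow> bool) \<Rightarrow> ('a \<Rightarrow> nat) \<Rightarrow> ('a \<times> 'a) set" where
  "forward_arcs V R p = {(u, v) \<in> V \<times> V. R u v \<and> p u < p v}"

text \<open>An order is an injective position function with gaps allowed, so adding a large constant
  to some positions moves those vertices to the end.\<close>

definition median_order :: "'a set \<Rightarrow> ('a \<Rightarrow> 'a \<Rightarrow> bool) \<Rightarrow> ('a \<Rightarrow> nat) \<Rightarrow> bool" where
  "median_order V R p \<longleftrightarrow> inj_on p V \<and>
     (\<forall>q. inj_on q V \<longrightarrow> card (forward_arcs V R q) \<le> card (forward_arcs V R p))"

lemma median_order_exists:
  assumes "finite V"
  shows "\<exists>p. median_order V R p"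
proof -
  obtain p0 :: "'a \<Rightarrow> nat" where p0: "inj_on p0 V"
    using finite_imp_inj_to_nat_seg[OF assms] by blast
  have "card (forward_arcs V R q) < Suc (card (V \<times> V))" for q
    by (rule le_imp_less_Suc, rule card_mono) (auto simp: assms forward_arcs_def)
  then have "\<exists>p. inj_on p V \<and>
      (\<forall>q. inj_on q V \<longrightarrow> card (forward_arcs V R q) \<le> card (forward_arcs V R p))"
    using ex_has_greatest_nat[of "\<lambda>q. inj_on q V" p0 "\<lambda>q. card (forward_arcs V R q)"
        "Suc (card (V \<times> V))"] p0 by (metis less_imp_le)
  then show ?thesis
    unfolding median_order_def .
qed

text \<open>The sum is the change in the number of forward arcs when \<open>A\<close> is moved
  behind all other vertices: only pairs of \<open>x\<close> in \<open>A\<close> with a later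
  \<open>y\<close> outside \<open>A\<close> are reversed, which gains an arc from \<open>y\<close>
  to \<open>x\<close> and loses one from \<open>x\<close> to \<open>y\<close>. A median order admits
  no gain.\<close>

lemma median_order_push_back:
  assumes fin: "finite V" and med: "median_order V R p" and A: "A \<subseteq> V"
  shows "(\<Sum>y\<in>V - A. \<Sum>x\<in>{x \<in> A. p x < p y}. of_bool (R y x) - of_bool (R x y) :: int) \<le> 0"
proof -
  have inj: "inj_on p V" using med by (simp add: median_order_def)
  \<comment> \<open>\<open>m\<close> exceeds all positions, so adding it puts \<open>A\<close> last
    and keeps the order within \<open>A\<close>.\<close>
  define m where "m = Suc (Max (p ` V))"
  have m: "p v < m" if "v \<in> V" for v
    using that fin by (simp add: m_def less_Suc_eq_le)
  define q where "q v = (if v \<in> A then p v + m else p v)" for v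
  have "inj_on q V"
  proof (rule inj_onI)
    fix u v assume "u \<in> V" "v \<in> V" "q u = q v"
    then show "u = v"
      using m[of u] m[of v] inj by (auto simp: q_def inj_on_def split: if_splits)
  qed
  then have le: "card (forward_arcs V R q) \<le> card (forward_arcs V R p)"
    using med by (simp add: median_order_def)
  have weight: "int (card (forward_arcs V R r))
      = (\<Sum>x\<in>V. \<Sum>y\<in>V. of_bool (R x y \<and> r x < r y))" for r :: "'a \<Rightarrow> nat"
  proof -
    have "forward_arcs V R r = {z \<in> V \<times> V. case z of (x, y) \<Rightarrow> R x y \<and> r x < r y}"
      by (auto simp: forward_arcs_def)
    then have "int (card (forward_arcs V R r))
        = (\<Sum>z\<in>V \<times> V. of_bool (case z of (x, y) \<Rightarrow> R x y \<and> r x < r y))"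
      using fin by (simp add: Int_def of_bool_def sum.If_cases)
    also have "\<dots> = (\<Sum>z\<in>V \<times> V. case z of (x, y) \<Rightarrow> of_bool (R x y \<and> r x < r y))"
      by (intro sum.cong) auto
    finally show ?thesis
      by (simp add: sum.cartesian_product)
  qed
  have finA: "finite A"
    using A fin finite_subset by auto
  have split: "(\<Sum>x\<in>V. \<Sum>y\<in>V. h x y) =
      (\<Sum>x\<in>A. \<Sum>y\<in>A. h x y) + (\<Sum>y\<in>V - A. \<Sum>x\<in>A. h x y + h y x)
      + (\<Sum>x\<in>V - A. \<Sum>y\<in>V - A. h x y)" for h :: "'a \<Rightarrow> 'a \<Rightarrow> int"
  proof -
    have s: "sum g V = sum g A + sum g (V - A)" for g :: "'a \<Rightarrow> int"
      using sum.subset_diff[OF A fin, of g] by simp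
    show ?thesis
      unfolding s sum.distrib by (simp add: sum.swap[of _ "V - A" A])
  qed
  \<comment> \<open>\<open>h x y\<close> is the change contributed by the ordered pair; it vanishes
    unless exactly one of \<open>x\<close>, \<open>y\<close> lies in \<open>A\<close>.\<close>
  define h :: "'a \<Rightarrow> 'a \<Rightarrow> int" where
    "h x y = of_bool (R x y \<and> q x < q y) - of_bool (R x y \<and> p x < p y)" for x y
  have "(\<Sum>x\<in>V. \<Sum>y\<in>V. h x y) = int (card (forward_arcs V R q)) - int (card (forward_arcs V R p))"
    by (simp add: weight h_def sum_subtractf)
  then have "(\<Sum>x\<in>V. \<Sum>y\<in>V. h x y) \<le> 0"
    using le by simp
  moreover have "(\<Sum>x\<in>A. \<Sum>y\<in>A. h x y) = 0"
    by (simp add: h_def q_def)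
  moreover have "(\<Sum>x\<in>V - A. \<Sum>y\<in>V - A. h x y) = 0"
    by (simp add: h_def q_def)
  moreover have "(\<Sum>y\<in>V - A. \<Sum>x\<in>A. h x y + h y x)
      = (\<Sum>y\<in>V - A. \<Sum>x\<in>{x \<in> A. p x < p y}. of_bool (R y x) - of_bool (R x y))"
  proof (rule sum.cong[OF refl])
    fix y assume y: "y \<in> V - A"
    have "(\<Sum>x\<in>{x \<in> A. p x < p y}. of_bool (R y x) - of_bool (R x y) :: int)
        = (\<Sum>x\<in>A. if p x < p y then of_bool (R y x) - of_bool (R x y) else 0)"
      using finA by (simp add: sum.inter_filter)
    also have "\<dots> = (\<Sum>x\<in>A. h x y + h y x)"
    proof (rule sum.cong[OF refl])
      fix x assume x: "x \<in> A"
      have "p x \<noteq> p y"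
        using inj x y A by (metis DiffD1 DiffD2 inj_onD subsetD)
      moreover have "q y < q x"
        using m[of y] x y by (simp add: q_def)
      ultimately show "(if p x < p y then of_bool (R y x) - of_bool (R x y) else 0) = h x y + h y x"
        by (auto simp: h_def)
    qed
    finally show "(\<Sum>x\<in>A. h x y + h y x)
        = (\<Sum>x\<in>{x \<in> A. p x < p y}. of_bool (R y x) - of_bool (R x y))" by simp
  qed
  ultimately show ?thesis
    using split[of h] by simp
qed

text \<open>
  If the claim failed, then choosing the final segment that maximizes the excess of \<open>N\<close> over \<open>G\<close>
  and pushing its vertices in \<open>N \<union> G\<close> behind \<open>f\<close> would produce a better order: by maximality
  no vertex outside \<open>N \<union> G\<close> loses in the exchange.
\<close>

lemma median_order_feed_vertex:
  fixes p :: "'a \<Rightarrow> nat"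
  assumes fin: "finite V" and med: "median_order V R p"
    and antisym: "\<And>u v. R u v \<Longrightarrow> \<not> R v u"
    and f: "f \<in> V" "\<And>v. v \<in> V \<Longrightarrow> v \<noteq> f \<Longrightarrow> p v < p f"
    and NG: "N \<subseteq> V - {f}" "G \<subseteq> V - {f}" "N \<inter> G = {}"
    and out: "\<And>u. u \<in> N \<Longrightarrow> R f u"
    and bad: "\<And>u b. u \<in> N \<Longrightarrow> b \<in> V - {f} - N - G \<Longrightarrow> p u < p b \<Longrightarrow> R b u"
  shows "card N \<le> card G" and "\<lbrakk>card N = card G; v \<in> G\<rbrakk> \<Longrightarrow> \<not> R f v"
proof -
  have finNG: "finite N" "finite G" using fin NG finite_subset by blast+
  define excess :: "nat \<Rightarrow> int" where
    "excess j = int (card {v \<in> N. j \<le> p v}) - int (card {v \<in> G. j \<le> p v})" for j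
  have key: "excess j + 2 * int (card {v \<in> G. j \<le> p v \<and> R f v}) \<le> 0"
    if max: "\<And>k. k \<le> p f \<Longrightarrow> excess k \<le> excess j" for j
  proof -
    define A where "A = {v \<in> N \<union> G. j \<le> p v}"
    define s :: "'a \<Rightarrow> 'a \<Rightarrow> int" where "s y x = of_bool (R y x) - of_bool (R x y)" for x y
    define I where "I y = (\<Sum>x\<in>{x \<in> A. p x < p y}. s y x)" for y
    have AV: "A \<subseteq> V" using NG by (auto simp: A_def)
    have total: "(\<Sum>y\<in>V - A. I y) \<le> 0"
      using median_order_push_back[OF fin med AV] by (simp add: I_def s_def)
    \<comment> \<open>\<open>I y\<close> is the gain from moving \<open>A\<close> behind
      \<open>y\<close>. Nothing in \<open>A\<close> precedes a vertex placed before
      \<open>j\<close>; for the others, \<open>N\<close> contributes 1 and \<open>G\<close> at least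
      -1 per vertex passed.\<close>
    have "0 \<le> I y" if y: "y \<in> V - A - {f}" for y
    proof (cases "j \<le> p y")
      case False
      then have "{x \<in> A. p x < p y} = {}" by (auto simp: A_def)
      then show ?thesis unfolding I_def by (simp only: sum.empty order.refl)
    next
      case True
      have yb: "y \<in> V - {f} - N - G" using y True by (auto simp: A_def)
      let ?N = "{x \<in> N. j \<le> p x \<and> p x < p y}" and ?G = "{x \<in> G. j \<le> p x \<and> p x < p y}"
      have "{x \<in> A. p x < p y} = ?N \<union> ?G" by (auto simp: A_def)
      moreover have "sum (s y) (?N \<union> ?G) = sum (s y) ?N + sum (s y) ?G"
        using NG finNG by (intro sum.union_disjoint) auto
      ultimately have "I y = sum (s y) ?N + sum (s y) ?G" by (simp add: I_def)
      moreover have "sum (s y) ?N = (\<Sum>x\<in>?N. 1)"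
        using bad[OF _ yb] antisym by (intro sum.cong) (auto simp: s_def)
      moreover have "sum (s y) ?G \<ge> (\<Sum>x\<in>?G. - 1)"
        by (intro sum_mono) (auto simp: s_def)
      \<comment> \<open>These are the vertices of \<open>N\<close> and \<open>G\<close> from
        position \<open>j\<close> up to \<open>y\<close>, so the maximality of
        \<open>excess j\<close> makes their balance nonnegative.\<close>
      moreover have "excess j - excess (p y) = int (card ?N) - int (card ?G)"
      proof -
        have "{v \<in> X. j \<le> p v} = {x \<in> X. j \<le> p x \<and> p x < p y} \<union> {v \<in> X. p y \<le> p v}" for X
          using True by auto
        moreover have "card ({x \<in> X. j \<le> p x \<and> p x < p y} \<union> {v \<in> X. p y \<le> p v})
            = card {x \<in> X. j \<le> p x \<and> p x < p y} + card {v \<in> X. p y \<le> p v}" if "finite X" for X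
          using that by (intro card_Un_disjoint) auto
        ultimately show ?thesis using finNG by (simp add: excess_def)
      qed
      moreover have "excess (p y) \<le> excess j"
        using max[of "p y"] f(2)[of y] y by auto
      ultimately show ?thesis by simp
    qed
    then have "0 \<le> (\<Sum>y\<in>V - A - {f}. I y)" by (intro sum_nonneg) auto
    moreover have "f \<in> V - A" using f NG by (auto simp: A_def)
    then have "(\<Sum>y\<in>V - A. I y) = I f + (\<Sum>y\<in>V - A - {f}. I y)"
      using fin by (simp add: sum.remove)
    \<comment> \<open>Each vertex of \<open>G\<close> costs at most 1, but one dominated by
      \<open>f\<close> gains 1 instead, hence the factor 2.\<close>
    moreover have "I f \<ge> excess j + 2 * int (card {v \<in> G. j \<le> p v \<and> R f v})"
    proof -
      let ?N = "{x \<in> N. j \<le> p x}" and ?G = "{x \<in> G. j \<le> p x}"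
      have "{x \<in> A. p x < p f} = ?N \<union> ?G" using f NG by (auto simp: A_def)
      moreover have "sum (s f) (?N \<union> ?G) = sum (s f) ?N + sum (s f) ?G"
        using NG finNG by (intro sum.union_disjoint) auto
      ultimately have "I f = sum (s f) ?N + sum (s f) ?G" by (simp add: I_def)
      moreover have "sum (s f) ?N = (\<Sum>x\<in>?N. 1)"
        using out antisym by (intro sum.cong) (auto simp: s_def)
      moreover have "sum (s f) ?G \<ge> (\<Sum>x\<in>?G. 2 * of_bool (R f x) - 1)"
        using antisym by (intro sum_mono) (auto simp: s_def)
      moreover have "(\<Sum>x\<in>?G. 2 * of_bool (R f x) - 1 :: int)
          = 2 * int (card {v \<in> G. j \<le> p v \<and> R f v}) - int (card ?G)"
      proof -
        have "(\<Sum>x\<in>?G. of_bool (R f x) :: int) = int (card (?G \<inter> {x. R f x}))"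
          using finNG by simp
        also have "?G \<inter> {x. R f x} = {v \<in> G. j \<le> p v \<and> R f v}" by auto
        finally show ?thesis by (simp add: sum_subtractf flip: sum_distrib_left)
      qed
      ultimately show ?thesis by (simp add: excess_def)
    qed
    ultimately show ?thesis using total by simp
  qed
  obtain j where j: "\<And>k. k \<le> p f \<Longrightarrow> excess k \<le> excess j"
  proof -
    have "finite (excess ` {..p f})" "excess ` {..p f} \<noteq> {}" by auto
    then have "Max (excess ` {..p f}) \<in> excess ` {..p f}" by (rule Max_in)
    then obtain j where "Max (excess ` {..p f}) = excess j" by (elim imageE)
    then have "excess k \<le> excess j" if "k \<le> p f" for k
      using Max_ge[of "excess ` {..p f}" "excess k"] that by simp
    then show thesis by (rule that)
  qed
  have "excess j \<le> 0" using key[OF j] by simp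
  then have nonpos: "excess k \<le> 0" if "k \<le> p f" for k using j[OF that] by simp
  have 0: "excess 0 = int (card N) - int (card G)" by (simp add: excess_def)
  then show "card N \<le> card G" using nonpos[of 0] by simp
  assume eq: "card N = card G" and v: "v \<in> G"
  \<comment> \<open>Now \<open>excess 0\<close> is 0, which is maximal since no excess is positive;
    so \<open>key\<close> applies to the whole order.\<close>
  have "card {v \<in> G. R f v} = 0"
    using key[of 0] nonpos 0 eq by simp
  then show "\<not> R f v" using finNG v by auto
qed

section \<open>Oriented graphs missing disjoint stars\<close>

text \<open>\<open>P a c\<close> means that \<open>{a, c}\<close> is a missing edge whose star has center \<open>c\<close>.\<close>

locale missing_stars =
  fixes V :: "'a set" and E P :: "'a \<Rightarrow> 'a \<Rightarrow> bool" and C :: "'a set"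
  assumes finite_V: "finite V" and V_nonempty: "V \<noteq> {}"
    and arc_verts: "E u v \<Longrightarrow> u \<in> V \<and> v \<in> V"
    and arc_asym: "E u v \<Longrightarrow> \<not> E v u"
    and missing_not_arc: "P a c \<Longrightarrow> \<not> E a c \<and> \<not> E c a"
    and arc_or_missing: "\<lbrakk>u \<in> V; v \<in> V; u \<noteq> v\<rbrakk> \<Longrightarrow> E u v \<or> E v u \<or> P u v \<or> P v u"
    and center: "P a c \<Longrightarrow> c \<in> C"
    and leaf_not_center: "P a c \<Longrightarrow> a \<notin> C"
    and center_unique: "\<lbrakk>P a c; P a d\<rbrakk> \<Longrightarrow> c = d"
    and centers_kings: "\<lbrakk>c \<in> C; d \<in> C; c \<noteq> d\<rbrakk> \<Longrightarrow> E c d \<or> (\<exists>w. E c w \<and> E w d)"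
    and loser_exists: "P a c \<Longrightarrow> \<exists>x1 y1 x2 y2. (P x1 y1 \<or> P y1 x1) \<and> {a, c} = {x2, y2} \<and>
       E x1 x2 \<and> (y2 = x1 \<or> \<not> E x1 y2 \<and> (\<nexists>w. E x1 w \<and> E w y2)) \<and>
       E y1 y2 \<and> (x2 = y1 \<or> \<not> E y1 x2 \<and> (\<nexists>w. E y1 w \<and> E w x2))"
begin

text \<open>A losing edge can match its endpoints with those of \<open>{a, c}\<close> in two ways.
  If \<open>c'\<close> dominated the leaf \<open>a\<close>, then \<open>c'\<close> could not reach
  \<open>c\<close> within two steps, although it is a king. In the other matching, the failures of
  reachability force \<open>E a c'\<close> and \<open>E c a'\<close>, as each leaf has a single
  center.\<close>

lemma loser_cycle:
  assumes P: "P a c"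
  obtains a' c' where "P a' c'" "E c' c" "E c a'" "E a' a" "E a c'"
    "\<And>w. E c' w \<Longrightarrow> \<not> E w a"
proof -
  note result = that
  \<comment> \<open>Here \<open>x\<close> is the endpoint dominated by the center \<open>c'\<close>,
    and \<open>y\<close> the one dominated by the leaf \<open>a'\<close>.\<close>
  have *: thesis if H: "P a' c'" "E c' x" "y = c' \<or> \<not> E c' y \<and> (\<nexists>w. E c' w \<and> E w y)"
    "E a' y" "x = a' \<or> \<not> E a' x \<and> (\<nexists>w. E a' w \<and> E w x)" "{a, c} = {x, y}" for a' c' x y
  proof (cases "x = c")
    case True
    with H(6) P have y: "y = a" by (auto simp: doubleton_eq_iff)
    \<comment> \<open>This excludes the degenerate cases \<open>y = c'\<close> and
      \<open>x = a'\<close>, which arise because no vertex is its own second out-neighbor.\<close>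
    have ne: "c' \<noteq> a" "c \<noteq> a'" "c \<noteq> c'"
      using center leaf_not_center P H(1,2) True arc_asym by blast+
    have "E a c'"
      using arc_or_missing[of a c'] ne H(3) y arc_verts[OF H(4)] arc_verts[OF H(2)]
        center_unique[OF P] leaf_not_center center P H(1) by blast
    moreover have "E c a'"
      using arc_or_missing[of c a'] ne H(5) True arc_verts[OF H(4)] arc_verts[OF H(2)]
        center_unique[OF H(1)] leaf_not_center center P H(1) by blast
    ultimately show thesis
      using result[OF H(1)] H y True ne by blast
  next
    case False
    with H(6) have xy: "x = a" "y = c" by (auto simp: doubleton_eq_iff)
    have "c' \<noteq> c" using missing_not_arc[OF P] H(2) xy by blast
    then show thesis
      using centers_kings[OF center[OF H(1)] center[OF P]] H(3) xy by blast
  qed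
  obtain x1 y1 x2 y2 where L: "P x1 y1 \<or> P y1 x1" "{a, c} = {x2, y2}" "E x1 x2"
    "y2 = x1 \<or> \<not> E x1 y2 \<and> (\<nexists>w. E x1 w \<and> E w y2)" "E y1 y2"
    "x2 = y1 \<or> \<not> E y1 x2 \<and> (\<nexists>w. E y1 w \<and> E w x2)"
    using loser_exists[OF P] by (elim exE conjE)
  have sw: "{a, c} = {y2, x2}" using L(2) by (simp add: insert_commute)
  from L(1) show thesis
  proof
    assume "P x1 y1"
    then show thesis by (rule *[OF _ L(5,6,3,4) sw])
  next
    assume "P y1 x1"
    then show thesis by (rule *[OF _ L(3,4,5,6,2)])
  qed
qed

lemma second_neighborhood:
  "\<exists>f\<in>V. card {w. E f w} \<le> card {w. w \<noteq> f \<and> \<not> E f w \<and> (\<exists>u. E f u \<and> E u w)}"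
proof -
  define R where "R u v \<longleftrightarrow> E u v \<or> P u v" for u v
  have R_asym: "R u v \<Longrightarrow> \<not> R v u" for u v
    unfolding R_def using arc_asym missing_not_arc center leaf_not_center by blast
  have R_total: "\<lbrakk>u \<in> V; v \<in> V; u \<noteq> v\<rbrakk> \<Longrightarrow> R u v \<or> R v u" for u v
    unfolding R_def using arc_or_missing by blast
  obtain p where med: "median_order V R p" using median_order_exists[OF finite_V] by blast
  obtain f where f: "f \<in> V" and f_max: "\<And>v. v \<in> V \<Longrightarrow> v \<noteq> f \<Longrightarrow> p v < p f"
  proof -
    have "Max (p ` V) \<in> p ` V" using finite_V V_nonempty by simp
    then obtain f where f: "f \<in> V" "Max (p ` V) = p f" by auto
    have "p v < p f" if v: "v \<in> V" "v \<noteq> f" for v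
    proof -
      have "p v \<le> p f" using Max_ge[of "p ` V" "p v"] finite_V v f by simp
      moreover have "p v \<noteq> p f"
        using med v f unfolding median_order_def by (meson inj_onD)
      ultimately show ?thesis by simp
    qed
    with f(1) show thesis by (rule that)
  qed
  define N where "N = {u. E f u}"
  define N2 where "N2 = {w. w \<noteq> f \<and> \<not> E f w \<and> (\<exists>u. E f u \<and> E u w)}"
  \<comment> \<open>By totality of \<open>R\<close>, a vertex outside \<open>N\<close>,
    \<open>G\<close> and \<open>{f}\<close> dominates all earlier vertices of \<open>N\<close>, as
    the feed vertex lemma requires.\<close>
  define G where "G = {v \<in> V - {f} - N. \<exists>u\<in>N. p u < p v \<and> R u v}"
  have N: "N \<subseteq> V - {f}" using arc_verts arc_asym by (auto simp: N_def)
  have G: "G \<subseteq> V - {f}" "N \<inter> G = {}" by (auto simp: G_def)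
  have N2: "N2 \<subseteq> V" using arc_verts by (auto simp: N2_def)
  have fin: "finite G" "finite N2"
    using finite_V G(1) N2 by (auto intro: finite_subset)
  have bad: "R b u" if "u \<in> N" "b \<in> V - {f} - N - G" "p u < p b" for u b
    using that R_total[of u b] N by (auto simp: G_def)
  have feed: "card N \<le> card G" "\<And>v. card N = card G \<Longrightarrow> v \<in> G \<Longrightarrow> \<not> R f v"
    using median_order_feed_vertex[OF finite_V med R_asym f f_max N G _ bad]
    by (auto simp: N_def R_def)
  have lost: "\<exists>a c'. P a v \<and> P f c' \<and> E f a \<and> E c' v \<and> (\<forall>w. E c' w \<longrightarrow> \<not> E w a)"
    if v: "v \<in> G - N2" for v
  proof -
    obtain a where a: "E f a" "R a v" and vf: "v \<noteq> f" "\<not> E f v"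
      using v by (auto simp: G_def N_def)
    then have "P a v" using v by (auto simp: N2_def R_def)
    then obtain a' c' where l: "P a' c'" "E c' v" "E a c'" "\<And>w. E c' w \<Longrightarrow> \<not> E w a"
      by (rule loser_cycle) blast
    \<comment> \<open>An arc from \<open>c'\<close> to \<open>f\<close> would give a path from
      \<open>c'\<close> through \<open>f\<close> to \<open>a\<close>; an arc from \<open>f\<close>
      to \<open>c'\<close> would put \<open>v\<close> in \<open>N2\<close>. Hence \<open>f\<close>
      and \<open>c'\<close> span a missing edge.\<close>
    have "\<not> E c' f" using l(4) a(1) by blast
    moreover have "f \<noteq> c'" using l(3) a(1) arc_asym by blast
    moreover have "\<not> E f c'" using v l(2) vf by (auto simp: N2_def)
    ultimately have "P f c'"
      using arc_or_missing[of f c'] f arc_verts[OF l(2)] center[OF l(1)] leaf_not_center by blast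
    then show ?thesis using \<open>P a v\<close> a(1) l by blast
  qed
  have "card N \<le> card N2"
  proof (cases "G \<subseteq> N2")
    case True
    then show ?thesis using card_mono[OF fin(2)] feed(1) le_trans by blast
  next
    case False
    then obtain v where v: "v \<in> G - N2" by blast
    then obtain c where c: "P f c" using lost by blast
    \<comment> \<open>All lost vertices share the center \<open>c\<close> of \<open>f\<close>. As
      \<open>c\<close> dominates \<open>v\<close> and does not reach \<open>a'\<close> in two steps,
      \<open>a'\<close> must dominate \<open>v\<close>, and the path through \<open>a'\<close> puts
      \<open>v\<close> in \<open>N2\<close>.\<close>
    have "v' = v" if v': "v' \<in> G - N2" for v'
    proof (rule ccontr)
      assume ne: "v' \<noteq> v"
      obtain a where a: "P a v" "E f a" "E c v" "\<And>w. E c w \<Longrightarrow> \<not> E w a"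
        using lost[OF v] center_unique[OF c] by blast
      obtain a' where a': "P a' v'" "E f a'" "E c v'" "\<And>w. E c w \<Longrightarrow> \<not> E w a'"
        using lost[OF v'] center_unique[OF c] by blast
      have "v \<noteq> a'" using center[OF a(1)] leaf_not_center[OF a'(1)] by blast
      moreover have "\<not> P a' v" using center_unique[OF a'(1)] ne by blast
      moreover have "\<not> P v a'" using center[OF a(1)] leaf_not_center by blast
      ultimately have "E a' v"
        using arc_or_missing[of a' v] a'(4)[OF a(3)] arc_verts[OF a'(2)] arc_verts[OF a(3)] by blast
      then show False using v a'(2) by (auto simp: N2_def G_def N_def)
    qed
    then have "G \<subseteq> insert v N2" by blast
    moreover have "c \<in> N2"
    proof -
      obtain c0 where "E c0 c" "E f c0" using c by (rule loser_cycle)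
      then show ?thesis using missing_not_arc[OF c] leaf_not_center[OF c] center[OF c]
        by (auto simp: N2_def)
    qed
    \<comment> \<open>If \<open>c\<close> is outside \<open>G\<close>, it replaces \<open>v\<close>
      and the size is kept. If \<open>c\<close> is in \<open>G\<close>, one vertex is lost, but
      \<open>R f c\<close> makes \<open>card N < card G\<close>.\<close>
    ultimately have "card (G - {v} \<union> {c}) \<le> card N2"
      by (intro card_mono fin) auto
    moreover have "v \<noteq> c" using v \<open>c \<in> N2\<close> by blast
    moreover have "card G > 0" using v fin(1) by (auto simp: card_gt_0_iff)
    moreover have "card N \<noteq> card G" if "c \<in> G"
      using feed(2)[OF _ that] c by (auto simp: R_def)
    ultimately show ?thesis
      using feed(1) v fin(1) by (cases "c \<in> G") (auto simp: insert_absorb card_insert_if)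
  qed
  then show ?thesis using f by (auto simp: N_def N2_def)
qed

end

section \<open>Transfer to tournaments with deleted stars\<close>

theorem theorem2:
  fixes T D :: "('a, 'b) pre_digraph"
    and n :: nat
    and S :: "nat \<Rightarrow> 'a set set"
    and x :: "nat \<Rightarrow> 'a"
  assumes "tournament T"
    and "\<forall>i\<in>{1..n}. star_with_center (x i) (S i)"
    and "\<forall>i\<in>{1..n}. S i \<subseteq> underlying_edges T"
    and "disjoint_family_on (\<lambda>i. \<Union>(S i)) {1..n}"
    and "D = delete_edges T (\<Union>i\<in>{1..n}. S i)"
    and "\<forall>v \<in> verts (D \<restriction> (x ` {1..n})). king (D \<restriction> (x ` {1..n})) v"
    and "\<forall>e \<in> verts (dependency_digraph D). in_degree (dependency_digraph D) e \<ge> 1"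
  shows "\<exists>v \<in> verts D. card (out_nbrs D v) \<le> card (second_out_nbrs D v)"
proof -
  define C where "C = x ` {1..n}"
  define P where "P a c \<longleftrightarrow> (\<exists>i\<in>{1..n}. c = x i \<and> a \<noteq> c \<and> {a, c} \<in> S i)" for a c
  interpret T: digraph T
    using assms(1) by (simp add: tournament_def oriented_graph_def)
  have verts: "verts D = verts T"
    by (simp add: assms(5) delete_edges_def)
  have arcD: "u \<rightarrow>\<^bsub>D\<^esub> v \<longleftrightarrow> u \<rightarrow>\<^bsub>T\<^esub> v \<and> {u, v} \<notin> (\<Union>i\<in>{1..n}. S i)" for u v
    by (auto simp: assms(5) delete_edges_def arcs_ends_def arc_to_ends_def)
  have edgeT: "u \<rightarrow>\<^bsub>T\<^esub> v \<or> v \<rightarrow>\<^bsub>T\<^esub> u" if "{u, v} \<in> S i" "i \<in> {1..n}" for u v i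
  proof -
    have "{u, v} \<in> underlying_edges T" using assms(3) that by blast
    then show ?thesis
      by (auto simp: underlying_edges_def doubleton_eq_iff arcs_ends_def arc_to_ends_def)
  qed
  have star: "P u v \<or> P v u" if "{u, v} \<in> S i" "i \<in> {1..n}" for u v i
  proof -
    have "star_with_center (x i) (S i)" using assms(2) that(2) by blast
    then obtain A where "x i \<notin> A" "S i = (\<lambda>a. {a, x i}) ` A"
      unfolding star_with_center_def by blast
    then have "u = x i \<and> v \<noteq> x i \<or> v = x i \<and> u \<noteq> x i"
      using that(1) by (auto simp: doubleton_eq_iff)
    then show ?thesis using that unfolding P_def by (auto simp: insert_commute)
  qed
  have center_in: "x i \<in> \<Union>(S i)" if "i \<in> {1..n}" for i
    using assms(2) that by (fastforce simp: star_with_center_def)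
  \<comment> \<open>Disjointness makes the star through a vertex unique: no leaf is a center, and
    each leaf has one center.\<close>
  have same: "i = j" if "u \<in> \<Union>(S i)" "u \<in> \<Union>(S j)" "i \<in> {1..n}" "j \<in> {1..n}" for u i j
    using assms(4) that unfolding disjoint_family_on_def by blast
  have missing: "{a, c} \<in> missing_edges D" if P: "P a c" for a c
  proof -
    obtain i where i: "i \<in> {1..n}" "a \<noteq> c" "{a, c} \<in> S i" using P by (auto simp: P_def)
    then have "{a, c} \<in> (\<Union>i\<in>{1..n}. S i)" by blast
    then have "\<not> a \<rightarrow>\<^bsub>D\<^esub> c" "\<not> c \<rightarrow>\<^bsub>D\<^esub> a" by (simp_all add: arcD insert_commute)
    moreover have "a \<in> verts D" "c \<in> verts D"
      using edgeT[OF i(3,1)] verts T.adj_in_verts by auto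
    ultimately show ?thesis using i(2) unfolding missing_edges_def by blast
  qed
  have missingD: "P u v \<or> P v u" if "u \<in> verts D" "v \<in> verts D" "u \<noteq> v"
    "\<not> u \<rightarrow>\<^bsub>D\<^esub> v" "\<not> v \<rightarrow>\<^bsub>D\<^esub> u" for u v
  proof -
    have "u \<rightarrow>\<^bsub>T\<^esub> v \<or> v \<rightarrow>\<^bsub>T\<^esub> u"
      using assms(1) that verts by (auto simp: tournament_def)
    then have "{u, v} \<in> (\<Union>i\<in>{1..n}. S i)"
      using that arcD by (auto simp: insert_commute)
    then show ?thesis using star by blast
  qed
  interpret missing_stars "verts D" "\<lambda>u v. u \<rightarrow>\<^bsub>D\<^esub> v" P C
  proof
    show "finite (verts D)" "verts D \<noteq> {}"
      using verts assms(1) by (auto simp: tournament_def oriented_graph_def)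
    show "u \<in> verts D \<and> v \<in> verts D" if "u \<rightarrow>\<^bsub>D\<^esub> v" for u v
      using that arcD verts T.adj_in_verts by auto
    show "\<not> v \<rightarrow>\<^bsub>D\<^esub> u" if "u \<rightarrow>\<^bsub>D\<^esub> v" for u v
      using that arcD assms(1) by (auto simp: tournament_def oriented_graph_def)
  next
    fix a c assume P: "P a c"
    from missing[OF P] show "\<not> a \<rightarrow>\<^bsub>D\<^esub> c \<and> \<not> c \<rightarrow>\<^bsub>D\<^esub> a"
      by (auto simp: missing_edges_def doubleton_eq_iff)
    show "c \<in> C" using P by (auto simp: P_def C_def)
    obtain i where i: "i \<in> {1..n}" "c = x i" "a \<noteq> c" "{a, c} \<in> S i" using P by (auto simp: P_def)
    have ai: "a \<in> \<Union>(S i)" using i(4) by blast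
    show "a \<notin> C"
    proof
      assume "a \<in> C"
      then obtain j where "j \<in> {1..n}" "a = x j" unfolding C_def by blast
      then show False using same[OF ai _ i(1)] center_in i(2,3) by blast
    qed
    show "c = d" if P': "P a d" for d
    proof -
      obtain j where j: "j \<in> {1..n}" "d = x j" "{a, d} \<in> S j" using P' by (auto simp: P_def)
      then have "i = j" using same[OF ai _ i(1) j(1)] by blast
      then show ?thesis using i j by simp
    qed
    have "in_degree (dependency_digraph D) {a, c} \<ge> 1"
      using assms(7) missing[OF P] by (simp add: dependency_digraph_def)
    then have "in_arcs (dependency_digraph D) {a, c} \<noteq> {}"
      unfolding in_degree_def by force
    then obtain e where e: "e \<in> missing_edges D" "loses_to D e {a, c}"
      by (auto simp: in_arcs_def dependency_digraph_def)
    obtain x1 y1 x2 y2 where l: "e = {x1, y1}" "{a, c} = {x2, y2}" "x1 \<rightarrow>\<^bsub>D\<^esub> x2"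
      "y2 \<notin> out_nbrs D x1 \<union> second_out_nbrs D x1" "y1 \<rightarrow>\<^bsub>D\<^esub> y2"
      "x2 \<notin> out_nbrs D y1 \<union> second_out_nbrs D y1"
      using e(2) unfolding loses_to_def by blast
    have "P x1 y1 \<or> P y1 x1"
      using e(1) l(1) missingD by (auto simp: missing_edges_def doubleton_eq_iff)
    with l(2-) show "\<exists>x1 y1 x2 y2. (P x1 y1 \<or> P y1 x1) \<and> {a, c} = {x2, y2} \<and>
       x1 \<rightarrow>\<^bsub>D\<^esub> x2 \<and> (y2 = x1 \<or> \<not> x1 \<rightarrow>\<^bsub>D\<^esub> y2 \<and> (\<nexists>w. x1 \<rightarrow>\<^bsub>D\<^esub> w \<and> w \<rightarrow>\<^bsub>D\<^esub> y2)) \<and>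
       y1 \<rightarrow>\<^bsub>D\<^esub> y2 \<and> (x2 = y1 \<or> \<not> y1 \<rightarrow>\<^bsub>D\<^esub> x2 \<and> (\<nexists>w. y1 \<rightarrow>\<^bsub>D\<^esub> w \<and> w \<rightarrow>\<^bsub>D\<^esub> x2))"
      unfolding out_nbrs_def second_out_nbrs_def by blast
  next
    fix u v assume "u \<in> verts D" "v \<in> verts D" "u \<noteq> v"
    then show "u \<rightarrow>\<^bsub>D\<^esub> v \<or> v \<rightarrow>\<^bsub>D\<^esub> u \<or> P u v \<or> P v u" using missingD by blast
  next
    fix c d assume cd: "c \<in> C" "d \<in> C" "c \<noteq> d"
    let ?H = "D \<restriction> C"
    \<comment> \<open>Paths among the centers are paths of \<open>D\<close>, so kings of the induced
      tournament reach each other in \<open>D\<close> within two steps.\<close>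
    have sub: "u \<rightarrow>\<^bsub>D\<^esub> v" if "u \<rightarrow>\<^bsub>?H\<^esub> v" for u v
      using that by (auto simp: induce_subgraph_def arcs_ends_def arc_to_ends_def)
    have "king ?H c" using assms(6) cd by (auto simp: C_def)
    then have "d \<in> {c} \<union> out_nbrs ?H c \<union> second_out_nbrs ?H c"
      using cd by (simp add: king_def)
    then show "c \<rightarrow>\<^bsub>D\<^esub> d \<or> (\<exists>w. c \<rightarrow>\<^bsub>D\<^esub> w \<and> w \<rightarrow>\<^bsub>D\<^esub> d)"
      using cd(3) sub unfolding out_nbrs_def second_out_nbrs_def by blast
  qed
  show ?thesis
    using second_neighborhood by (simp add: out_nbrs_def second_out_nbrs_def)
qed

end
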